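(* Let $f:\mathbb{R}^n\to\mathbb{R}$ be convex and differentiable with $L$-Lipschitz continuous gradient ($L>0$), let $s\in\mathbb{N}$, and assume that $f$ is bounded below on $A_s=\{w\in\mathbb{R}^n:\|w\|_0\le s\}$. Let $\lambda\in(0,L^{-1})$, and let $\{w^k\}_{k\ge0}$ be any sequence satisfying $w^{k+1}\in T^\lambda_{\mathrm{PG}}(w^k):=P_{A_s}(w^k-\lambda\nabla f(w^k))$ for all $k\ge0$. If $w^k\to w^*$ (which is the case, for instance, when $w^*$ is an accumulation point of $\{w^k\}$ at which $T^\lambda_{\mathrm{PG}}(w^* )$ is a singleton), then $$f(w^k)-f(w^* )=o(k^{-1}).$$ Moreover, if $w^*$ is an accumulation point of $\{w^k\}$ such that $T^\lambda_{\mathrm{PG}}(w^* )$ is a singleton and $w\mapsto w-\lambda\nabla f(w)$ is a contraction over $A_J$ for all $J\in\mathcal{I}_{w^*}$, then the objective converges to $f(w^* )$ $R$-linearly, i.e., there are constants $C,c>0$ such that $f(w^k)-f(w^* )\le C\exp(-ck)$ for all $k$.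
   Context: $\|w\|_0$ is the number of nonzero components of $w\in\mathbb{R}^n$; $\|\cdot\|$ is the Euclidean norm. $P_{A_s}(z)$ is the (possibly set-valued) projection, i.e. the set of all points of $A_s$ at minimal Euclidean distance from $z$. $\mathcal{J}_s:=\{J\subseteq\{1,\dots,n\}:|J|=s\}$, $A_J:=\mathrm{span}\{e_j:j\in J\}$ with $e_j$ the $j$th standard unit vector, and $\mathcal{I}_{w^*}:=\{J\in\mathcal{J}_s:w^*\in A_J\}$. A map $F$ is a contraction over $A_J$ if there is $\gamma_J\in[0,1)$ with $\|F(w)-F(w')\|\le\gamma_J\|w-w'\|$ for all $w,w'\in A_J$.
   Formalization: The R-linear claim is stated only for s ≤ n: for s > n there are no index sets of size s, so the contraction condition is vacuous and the claim fails (e.g. n = 1, s = 2, f equal to w^4 near 0). *)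

theory Defs
  imports "HOL-Analysis.Analysis" "HOL-Library.Landau_Symbols"
begin

definition gradient :: "('a::euclidean_space \<Rightarrow> real) \<Rightarrow> 'a \<Rightarrow> 'a" where
  "gradient f x = (THE g. GDERIV f x :> g)"

lemma gradient_eqI:
  fixes f :: "'a::euclidean_space \<Rightarrow> real"
  assumes "GDERIV f x :> g"
  shows "gradient f x = g"
  unfolding gradient_def
proof (rule the_equality)
  fix h assume "GDERIV f x :> h"
  with assms have "(\<lambda>y. y \<bullet> g) = (\<lambda>y. y \<bullet> h)"
    unfolding gderiv_def by (rule has_derivative_unique)
  then show "h = g"
    by (metis inner_commute vector_eq_ldot)
qed (rule assms)

lemma GDERIV_gradient:
  fixes f :: "'a::euclidean_space \<Rightarrow> real"
  assumes "f differentiable at x"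
  shows "GDERIV f x :> gradient f x"
proof -
  obtain D where D: "(f has_derivative D) (at x)"
    using assms by (auto simp: differentiable_def)
  then interpret D: linear D
    by (rule has_derivative_linear)
  have "D = (\<lambda>h. h \<bullet> (\<Sum>b\<in>Basis. D b *\<^sub>R b))"
  proof
    fix h
    have "D h = D (\<Sum>b\<in>Basis. (h \<bullet> b) *\<^sub>R b)"
      by (simp add: euclidean_representation)
    also have "\<dots> = h \<bullet> (\<Sum>b\<in>Basis. D b *\<^sub>R b)"
      by (simp add: D.sum D.scale inner_sum_right mult.commute)
    finally show "D h = h \<bullet> (\<Sum>b\<in>Basis. D b *\<^sub>R b)" .
  qed
  with D have "GDERIV f x :> (\<Sum>b\<in>Basis. D b *\<^sub>R b)"
    by (simp add: gderiv_def)
  then show ?thesis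
    using gradient_eqI by metis
qed

definition l0_norm :: "real ^ 'n \<Rightarrow> nat" where
  "l0_norm w = card {i. w $ i \<noteq> 0}"

definition sparse_set :: "nat \<Rightarrow> (real ^ 'n) set" where
  "sparse_set s = {w. l0_norm w \<le> s}"

text \<open>Set-valued: the library's \<^const>\<open>closest_point\<close> picks a single minimizer.\<close>

definition proj_set :: "'a::metric_space set \<Rightarrow> 'a \<Rightarrow> 'a set" where
  "proj_set S z = {x \<in> S. \<forall>y\<in>S. dist z x \<le> dist z y}"

definition gradient_step :: "(real ^ 'n \<Rightarrow> real) \<Rightarrow> real \<Rightarrow> real ^ 'n \<Rightarrow> real ^ 'n" where
  "gradient_step f lam w = w - lam *\<^sub>R gradient f w"

definition T_PG :: "(real ^ 'n \<Rightarrow> real) \<Rightarrow> nat \<Rightarrow> real \<Rightarrow> real ^ 'n \<Rightarrow> (real ^ 'n) set" where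
  "T_PG f s lam w = proj_set (sparse_set s) (gradient_step f lam w)"

text \<open>Exactly \<open>s\<close> elements, hence no index set at all if \<open>s > CARD('n)\<close>.\<close>

definition index_sets :: "nat \<Rightarrow> 'n::finite set set" where
  "index_sets s = {J. card J = s}"

definition coord_subspace :: "'n set \<Rightarrow> (real ^ 'n) set" where
  "coord_subspace J = span ((\<lambda>j. axis j 1) ` J)"

definition active_index_sets :: "nat \<Rightarrow> real ^ 'n \<Rightarrow> 'n set set" where
  "active_index_sets s w = {J \<in> index_sets s. w \<in> coord_subspace J}"

definition contraction_over :: "'a::metric_space set \<Rightarrow> ('a \<Rightarrow> 'a) \<Rightarrow> bool" where
  "contraction_over S F \<longleftrightarrow> (\<exists>\<gamma><1. \<gamma>-lipschitz_on S F)"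

definition accumulation_point :: "(nat \<Rightarrow> 'a::topological_space) \<Rightarrow> 'a \<Rightarrow> bool" where
  "accumulation_point w x \<longleftrightarrow> (\<exists>r. strict_mono r \<and> (w \<circ> r) \<longlonglongrightarrow> x)"

end

theory Submission
  imports Defs
begin

text \<open>
  The sparse set is a finite union of coordinate subspaces, and near a limit point \<open>u\<close> the method
  behaves as if only subspaces containing \<open>u\<close> existed. A point \<open>p\<close> close to \<open>u\<close> is nonzero
  wherever \<open>u\<close> is, so if \<open>p\<close> is sparse, the whole line through \<open>p\<close> and \<open>u\<close> is sparse. If \<open>p\<close> is
  moreover a nearest sparse point of \<open>z\<close>, then \<open>z - p\<close> is orthogonal to that line. For the iterates,
  this orthogonality replaces the variational inequality of projections onto convex sets, and with
  the usual quadratic upper bound and convexity it yields (\<open>three_point_inequality\<close>)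
  \<open>f (w (k + 1)) - f u \<le> ((dist (w k) u)\<^sup>2 - (dist (w (k + 1)) u)\<^sup>2) / (2 * lam)\<close>,
  provided that \<open>w (k + 1)\<close> is nonzero wherever \<open>u\<close> is.

  All three claims rest on this inequality. If \<open>u\<close> is an accumulation point, the objective, which
  decreases from the first sparse iterate on, never falls below \<open>f u\<close>. Hence the distance to \<open>u\<close>
  does not grow near \<open>u\<close>; since the steps tend to zero, the iterates get trapped near \<open>u\<close> and
  converge to it (\<open>accumulation_point_imp_limit\<close>). For large \<open>n\<close>, telescoping the inequality from
  \<open>n div 2\<close> to \<open>n\<close> bounds \<open>n * (f (w n) - f u)\<close> by a multiple of the squared distance at step
  \<open>n div 2\<close>, which tends to zero (\<open>objective_rate\<close>). Finally, \<open>u\<close> is a fixed point, so the same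
  orthogonality holds for its own gradient step, and the projection does not increase the distance
  between the gradient steps of \<open>w k\<close> and \<open>u\<close>. Under the contraction hypothesis the distances to
  \<open>u\<close> eventually decay geometrically, and by the inequality so does the objective gap
  (\<open>objective_linear_rate\<close>).
\<close>

section \<open>First-order estimates for smooth convex functions\<close>

lemma gradient_has_derivative_along_line:
  fixes f :: "'a::real_inner \<Rightarrow> real"
  assumes "GDERIV f (x + t *\<^sub>R d) :> g"
  shows "((\<lambda>t. f (x + t *\<^sub>R d)) has_real_derivative g \<bullet> d) (at t)"
proof -
  have 1: "(f has_derivative (\<lambda>h. h \<bullet> g)) (at (x + t *\<^sub>R d))"
    using assms by (simp add: gderiv_def)
  have 2: "((\<lambda>t. x + t *\<^sub>R d) has_derivative (\<lambda>h. h *\<^sub>R d)) (at t)"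
    by (auto intro!: derivative_eq_intros)
  have "((\<lambda>t. f (x + t *\<^sub>R d)) has_derivative (\<lambda>h. (h *\<^sub>R d) \<bullet> g)) (at t)"
    using has_derivative_compose[OF 2 1] by simp
  then show ?thesis
    by (simp add: has_field_derivative_def inner_commute mult_commute_abs)
qed

lemma convex_above_tangent_hyperplane:
  fixes f :: "'a::real_inner \<Rightarrow> real"
  assumes "convex_on UNIV f" and "GDERIV f x :> g"
  shows "f x + g \<bullet> (y - x) \<le> f y"
proof -
  let ?h = "\<lambda>t. f (x + t *\<^sub>R (y - x))"
  have conv: "convex_on UNIV ?h"
  proof (rule convex_onI)
    fix t a b :: real assume t: "0 < t" "t < 1"
    have "x + ((1 - t) *\<^sub>R a + t *\<^sub>R b) *\<^sub>R (y - x)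
        = (1 - t) *\<^sub>R (x + a *\<^sub>R (y - x)) + t *\<^sub>R (x + b *\<^sub>R (y - x))"
      by (simp add: algebra_simps)
    then show "?h ((1 - t) *\<^sub>R a + t *\<^sub>R b) \<le> (1 - t) * ?h a + t * ?h b"
      using convex_onD[OF assms(1), of t "x + a *\<^sub>R (y - x)" "x + b *\<^sub>R (y - x)"] t by simp
  qed simp
  have "(?h has_real_derivative g \<bullet> (y - x)) (at 0)"
    using assms(2) by (intro gradient_has_derivative_along_line) simp
  then show ?thesis
    using convex_on_imp_above_tangent[OF conv, of 0 1 "g \<bullet> (y - x)"] by simp
qed

lemma lipschitz_gradient_quadratic_upper_bound:
  fixes f :: "'a::real_inner \<Rightarrow> real"
  assumes "\<And>x. GDERIV f x :> G x" and "L-lipschitz_on UNIV G"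
  shows "f y \<le> f x + G x \<bullet> (y - x) + L / 2 * (norm (y - x))\<^sup>2"
proof -
  define d where "d = y - x"
  \<comment> \<open>Along the segment, \<open>h\<close> is \<open>f\<close> minus the bound; the Lipschitz condition makes it nonincreasing.\<close>
  define h where "h t = f (x + t *\<^sub>R d) - t * (G x \<bullet> d) - L / 2 * t\<^sup>2 * (norm d)\<^sup>2" for t
  have "h 1 \<le> h 0"
  proof (rule DERIV_nonpos_imp_nonincreasing[of 0 1 h])
    fix t :: real assume t: "0 \<le> t" "t \<le> 1"
    have "(h has_real_derivative G (x + t *\<^sub>R d) \<bullet> d - G x \<bullet> d - L * t * (norm d)\<^sup>2) (at t)"
      unfolding h_def
      by (rule derivative_eq_intros gradient_has_derivative_along_line assms(1) refl | simp)+
    moreover have "(G (x + t *\<^sub>R d) - G x) \<bullet> d \<le> L * t * (norm d)\<^sup>2"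
    proof -
      have "(G (x + t *\<^sub>R d) - G x) \<bullet> d \<le> norm (G (x + t *\<^sub>R d) - G x) * norm d"
        by (rule norm_cauchy_schwarz)
      also have "\<dots> \<le> (L * norm (t *\<^sub>R d)) * norm d"
        using lipschitz_onD[OF assms(2), of "x + t *\<^sub>R d" x]
        by (intro mult_right_mono) (auto simp: dist_norm)
      finally show ?thesis
        using t by (simp add: power2_eq_square mult.assoc)
    qed
    ultimately show "\<exists>z. (h has_real_derivative z) (at t) \<and> z \<le> 0"
      by (auto simp: inner_diff_left)
  qed simp
  then show ?thesis
    by (simp add: h_def d_def)
qed

section \<open>Projection onto sparse vectors\<close>

text \<open>
  Nearest points satisfy no variational inequality on a nonconvex set, but they do along every line
  of the set through them, and there it is an equality because both directions are admissible.
\<close>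

lemma proj_set_orthogonal_to_line:
  fixes z p v :: "'a::real_inner"
  assumes p: "p \<in> proj_set S z" and line: "\<And>t. p + t *\<^sub>R v \<in> S"
  shows "(z - p) \<bullet> v = 0"
proof -
  have no_pos: "\<not> (z - p) \<bullet> v' > 0" if "v' = v \<or> v' = - v" for v'
  proof
    assume "(z - p) \<bullet> v' > 0"
    then obtain u where "dist (p + u *\<^sub>R v') z < dist p z"
      using closer_point_lemma[of z p "p + v'"] by auto
    moreover have "p + u *\<^sub>R v' \<in> S"
      using that line[of u] line[of "- u"] by auto
    ultimately show False
      using p by (fastforce simp: proj_set_def dist_commute)
  qed
  show ?thesis
    using no_pos[of v] no_pos[of "- v"] by simp
qed

lemma sparse_set_line:
  fixes p u :: "real ^ 'n"
  assumes "{i. u $ i \<noteq> 0} \<subseteq> {i. p $ i \<noteq> 0}" and "p \<in> sparse_set s"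
  shows "a *\<^sub>R p + b *\<^sub>R u \<in> sparse_set s"
proof -
  have "card {i. (a *\<^sub>R p + b *\<^sub>R u) $ i \<noteq> 0} \<le> card {i. p $ i \<noteq> 0}"
    using assms(1) by (intro card_mono) auto
  then show ?thesis
    using assms(2) by (simp add: sparse_set_def l0_norm_def)
qed

lemma eventually_support_superset:
  fixes u :: "real ^ 'n"
  shows "\<forall>\<^sub>F p in nhds u. {i. u $ i \<noteq> 0} \<subseteq> {i. p $ i \<noteq> 0}"
proof -
  have "\<forall>\<^sub>F p in nhds u. \<forall>i\<in>{i. u $ i \<noteq> 0}. p $ i \<noteq> 0"
    by (intro eventually_ball_finite ballI tendsto_imp_eventually_ne[OF tendsto_vec_nth[OF filterlim_ident]])
       auto
  then show ?thesis
    by (rule eventually_mono) auto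
qed

lemma in_coord_subspace:
  fixes x :: "real ^ 'n"
  assumes "{i. x $ i \<noteq> 0} \<subseteq> J"
  shows "x \<in> coord_subspace J"
proof -
  have "x = (\<Sum>i\<in>UNIV. x $ i *\<^sub>R axis i 1)"
    using basis_expansion[of x] by (simp add: scalar_mult_eq_scaleR)
  also have "\<dots> = (\<Sum>i\<in>J. x $ i *\<^sub>R axis i 1)"
    using assms by (intro sum.mono_neutral_right) auto
  also have "\<dots> \<in> coord_subspace J"
    unfolding coord_subspace_def by (intro span_sum span_scale span_base) auto
  finally show ?thesis .
qed

section \<open>Projected gradient iterations\<close>

locale sparse_projected_gradient =
  fixes f :: "real ^ 'n \<Rightarrow> real" and L lam :: real and s :: nat and w :: "nat \<Rightarrow> real ^ 'n"
  assumes convex: "convex_on UNIV f"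
    and differentiable: "\<And>x. f differentiable at x"
    and L_pos: "L > 0"
    and Lipschitz: "L-lipschitz_on UNIV (gradient f)"
    and step_size: "0 < lam" "lam < 1 / L"
    and iteration: "\<And>k. w (Suc k) \<in> T_PG f s lam (w k)"
begin

lemma inverse_step_gt: "L < 1 / lam"
  using step_size L_pos by (simp add: field_simps)

lemma continuous_f: "isCont f x"
  using differentiable by (rule differentiable_imp_continuous_within)

lemma continuous_gradient_step: "isCont (gradient_step f lam) x"
proof -
  have "isCont (gradient f) x"
    using lipschitz_on_continuous_on[OF Lipschitz] by (simp add: continuous_on_eq_continuous_at)
  then show ?thesis
    unfolding gradient_step_def[abs_def] by (intro continuous_intros)
qed

lemma iterate_sparse: "w (Suc k) \<in> sparse_set s"
  using iteration[of k] by (simp add: T_PG_def proj_set_def)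

lemma quadratic_upper_bound:
  "f y \<le> f x + gradient f x \<bullet> (y - x) + L / 2 * (norm (y - x))\<^sup>2"
  by (rule lipschitz_gradient_quadratic_upper_bound[OF GDERIV_gradient[OF differentiable] Lipschitz])

lemma above_tangent: "f x + gradient f x \<bullet> (y - x) \<le> f y"
  by (rule convex_above_tangent_hyperplane[OF convex GDERIV_gradient[OF differentiable]])

text \<open>
  The current iterate competes in the projection that defines the next one. The index starts at
  one because the initial point may fail to be sparse.
\<close>

lemma sufficient_decrease:
  "(1 / lam - L) / 2 * (norm (w (Suc (Suc k)) - w (Suc k)))\<^sup>2 \<le> f (w (Suc k)) - f (w (Suc (Suc k)))"
proof -
  let ?x = "w (Suc k)" and ?y = "w (Suc (Suc k))"
  let ?g = "gradient f ?x"
  have expand: "2 * (a \<bullet> b) + (norm b)\<^sup>2 \<le> 0" if "(norm (a + b))\<^sup>2 \<le> (norm a)\<^sup>2"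
    for a b :: "real ^ 'n"
    using that by (simp add: dot_norm field_simps)
  have "dist (gradient_step f lam ?x) ?y \<le> dist (gradient_step f lam ?x) ?x"
    using iteration[of "Suc k"] iterate_sparse[of k] by (auto simp: T_PG_def proj_set_def)
  then have "norm (lam *\<^sub>R ?g + (?y - ?x)) \<le> norm (lam *\<^sub>R ?g)"
    by (simp add: gradient_step_def dist_norm norm_minus_commute algebra_simps)
  then have "(norm (lam *\<^sub>R ?g + (?y - ?x)))\<^sup>2 \<le> (norm (lam *\<^sub>R ?g))\<^sup>2"
    by simp
  then have "2 * lam * (?g \<bullet> (?y - ?x)) + (norm (?y - ?x))\<^sup>2 \<le> 0"
    using expand[of "lam *\<^sub>R ?g" "?y - ?x"] by (simp add: mult.assoc)
  then have "?g \<bullet> (?y - ?x) \<le> - (norm (?y - ?x))\<^sup>2 / (2 * lam)"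
    using step_size by (simp add: field_simps)
  moreover have "(1 / lam - L) / 2 * (norm (?y - ?x))\<^sup>2
      = (norm (?y - ?x))\<^sup>2 / (2 * lam) - L / 2 * (norm (?y - ?x))\<^sup>2"
    using step_size by (simp add: field_simps)
  ultimately show ?thesis
    using quadratic_upper_bound[of ?y ?x] by linarith
qed

lemma objective_decreasing: "decseq (\<lambda>k. f (w (Suc k)))"
proof (rule decseq_SucI)
  fix k
  have "0 \<le> (1 / lam - L) / 2 * (norm (w (Suc (Suc k)) - w (Suc k)))\<^sup>2"
    using inverse_step_gt by simp
  then show "f (w (Suc (Suc k))) \<le> f (w (Suc k))"
    using sufficient_decrease[of k] by linarith
qed

lemma residual_orthogonal:
  assumes "{i. u $ i \<noteq> 0} \<subseteq> {i. w (Suc k) $ i \<noteq> 0}"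
  shows "(gradient_step f lam (w k) - w (Suc k)) \<bullet> (w (Suc k) - u) = 0"
proof (rule proj_set_orthogonal_to_line)
  show "w (Suc k) \<in> proj_set (sparse_set s) (gradient_step f lam (w k))"
    using iteration by (simp add: T_PG_def)
  fix t
  have "w (Suc k) + t *\<^sub>R (w (Suc k) - u) = (1 + t) *\<^sub>R w (Suc k) + (- t) *\<^sub>R u"
    by (simp add: algebra_simps)
  then show "w (Suc k) + t *\<^sub>R (w (Suc k) - u) \<in> sparse_set s"
    by (simp only: sparse_set_line[OF assms iterate_sparse])
qed

text \<open>
  This is the estimate of the convex proximal gradient method. Its convex proof needs the
  variational inequality of the projection only at the comparison point \<open>u\<close>, and
  orthogonality of the residual supplies that.
\<close>

lemma three_point_inequality:
  assumes "{i. u $ i \<noteq> 0} \<subseteq> {i. w (Suc k) $ i \<noteq> 0}"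
  shows "f (w (Suc k)) - f u \<le> ((dist (w k) u)\<^sup>2 - (dist (w (Suc k)) u)\<^sup>2) / (2 * lam)"
proof -
  let ?x = "w k" and ?y = "w (Suc k)"
  let ?g = "gradient f ?x"
  have "lam * (?g \<bullet> (?y - u)) = (?x - ?y) \<bullet> (?y - u)"
    using residual_orthogonal[OF assms] by (simp add: gradient_step_def inner_diff_left)
  also have "2 * \<dots> = (dist ?x u)\<^sup>2 - (dist ?y u)\<^sup>2 - (norm (?y - ?x))\<^sup>2"
    unfolding dist_norm power2_norm_eq_inner
    by (simp add: inner_diff_left inner_diff_right inner_commute)
  finally have g: "?g \<bullet> (?y - u) = ((dist ?x u)\<^sup>2 - (dist ?y u)\<^sup>2 - (norm (?y - ?x))\<^sup>2) / (2 * lam)"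
    using step_size by (simp add: field_simps)
  have "f ?y - f u \<le> ?g \<bullet> (?y - u) + L / 2 * (norm (?y - ?x))\<^sup>2"
    using quadratic_upper_bound[of ?y ?x] above_tangent[of ?x u] by (simp add: inner_diff_right)
  also have "\<dots> = ((dist ?x u)\<^sup>2 - (dist ?y u)\<^sup>2) / (2 * lam)
      - (1 / lam - L) / 2 * (norm (?y - ?x))\<^sup>2"
    unfolding g using step_size by (simp add: field_simps)
  also have "\<dots> \<le> ((dist ?x u)\<^sup>2 - (dist ?y u)\<^sup>2) / (2 * lam)"
    using inverse_step_gt by simp
  finally show ?thesis .
qed

section \<open>Convergence of the iterates\<close>

lemma accumulation_value_le:
  assumes "accumulation_point w u"
  shows "f u \<le> f (w (Suc k))"
proof -
  obtain r where r: "strict_mono r" "(w \<circ> r) \<longlonglongrightarrow> u"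
    using assms by (auto simp: accumulation_point_def)
  have "(\<lambda>j. f ((w \<circ> r) j)) \<longlonglongrightarrow> f u"
    by (rule isCont_tendsto_compose[OF continuous_f r(2)])
  moreover have "\<forall>\<^sub>F j in sequentially. f ((w \<circ> r) j) \<le> f (w (Suc k))"
  proof (rule eventually_sequentiallyI)
    fix j assume "Suc k \<le> j"
    then have "Suc k \<le> r j"
      using seq_suble[OF r(1), of j] by linarith
    then show "f ((w \<circ> r) j) \<le> f (w (Suc k))"
      using decseqD[OF objective_decreasing, of k "r j - 1"] by simp
  qed
  ultimately show ?thesis
    by (rule tendsto_upperbound) simp
qed

lemma steps_vanish:
  assumes "accumulation_point w u"
  shows "(\<lambda>k. dist (w (Suc k)) (w k)) \<longlonglongrightarrow> 0"
proof -
  define c where "c = (1 / lam - L) / 2"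
  have c: "c > 0"
    using inverse_step_gt by (simp add: c_def)
  obtain l where l: "(\<lambda>k. f (w (Suc k))) \<longlonglongrightarrow> l"
    using decseq_convergent[OF objective_decreasing] accumulation_value_le[OF assms] by metis
  have "(\<lambda>k. (f (w (Suc k)) - f (w (Suc (Suc k)))) / c) \<longlonglongrightarrow> (l - l) / c"
    using c by (intro tendsto_intros l LIMSEQ_Suc[OF l]) simp
  then have *: "(\<lambda>k. (f (w (Suc k)) - f (w (Suc (Suc k)))) / c) \<longlonglongrightarrow> 0"
    by simp
  have "(\<lambda>k. (dist (w (Suc (Suc k))) (w (Suc k)))\<^sup>2) \<longlonglongrightarrow> 0"
  proof (rule tendsto_sandwich[OF _ _ tendsto_const *])
    show "\<forall>\<^sub>F k in sequentially. (dist (w (Suc (Suc k))) (w (Suc k)))\<^sup>2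
        \<le> (f (w (Suc k)) - f (w (Suc (Suc k)))) / c"
      using sufficient_decrease c by (simp add: c_def[symmetric] dist_norm field_simps)
  qed simp
  then have "(\<lambda>k. sqrt ((dist (w (Suc (Suc k))) (w (Suc k)))\<^sup>2)) \<longlonglongrightarrow> sqrt 0"
    by (rule tendsto_real_sqrt)
  then have "(\<lambda>k. dist (w (Suc (Suc k))) (w (Suc k))) \<longlonglongrightarrow> 0"
    by simp
  then show ?thesis
    by (rule LIMSEQ_imp_Suc)
qed

text \<open>
  The iterates are Fejer monotone with respect to \<open>u\<close> as long as their supports contain
  that of \<open>u\<close>, hence inside a small ball around \<open>u\<close>. Since steps become shorter than the
  margin between two such balls, the iterates can never leave once they are inside the smaller one.
\<close>

lemma accumulation_point_imp_limit:
  assumes acc: "accumulation_point w u"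
  shows "w \<longlonglongrightarrow> u"
proof -
  obtain r where r: "strict_mono r" "(w \<circ> r) \<longlonglongrightarrow> u"
    using acc by (auto simp: accumulation_point_def)
  obtain \<delta> where \<delta>: "\<delta> > 0"
    "\<And>p. dist p u < \<delta> \<Longrightarrow> {i. u $ i \<noteq> 0} \<subseteq> {i. p $ i \<noteq> 0}"
    using eventually_support_superset[of u] unfolding eventually_nhds_metric by auto
  have fejer: "dist (w (Suc k)) u \<le> dist (w k) u" if "dist (w (Suc k)) u < \<delta>" for k
  proof -
    have "0 \<le> ((dist (w k) u)\<^sup>2 - (dist (w (Suc k)) u)\<^sup>2) / (2 * lam)"
      using three_point_inequality[OF \<delta>(2)[OF that]] accumulation_value_le[OF acc, of k] by linarith
    then have "(dist (w (Suc k)) u)\<^sup>2 \<le> (dist (w k) u)\<^sup>2"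
      using step_size by (simp add: zero_le_divide_iff)
    then show ?thesis
      by (rule power2_le_imp_le) simp
  qed
  obtain K where K: "\<And>k. k \<ge> K \<Longrightarrow> dist (w (Suc k)) (w k) < \<delta> / 2"
    using LIMSEQ_D[OF steps_vanish[OF acc], of "\<delta> / 2"] \<delta>(1) by auto
  show ?thesis
  proof (rule metric_LIMSEQ_I)
    fix e :: real assume "e > 0"
    define \<epsilon> where "\<epsilon> = min e (\<delta> / 2)"
    have "\<epsilon> > 0"
      using \<open>e > 0\<close> \<delta>(1) by (simp add: \<epsilon>_def)
    then obtain N where "\<And>j. j \<ge> N \<Longrightarrow> dist (w (r j)) u < \<epsilon>"
      using metric_LIMSEQ_D[OF r(2)] by auto
    then have start: "dist (w (r (max K N))) u < \<epsilon>"
      by simp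
    have "dist (w k) u < \<epsilon>" if "k \<ge> r (max K N)" for k
      using that
    proof (induction k rule: dec_induct)
      case (step k)
      have "k \<ge> K"
        using step.hyps seq_suble[OF r(1), of "max K N"] by simp
      then have "dist (w (Suc k)) u < \<delta>"
        using K[of k] step.IH dist_triangle[of "w (Suc k)" u "w k"] by (simp add: \<epsilon>_def)
      then show ?case
        using fejer step.IH by fastforce
    qed (rule start)
    then show "\<exists>N. \<forall>k\<ge>N. dist (w k) u < e"
      by (auto simp: \<epsilon>_def)
  qed
qed

lemma eventually_iterates_support_superset:
  assumes "w \<longlonglongrightarrow> u"
  obtains K where "\<And>k. k \<ge> K \<Longrightarrow> {i. u $ i \<noteq> 0} \<subseteq> {i. w k $ i \<noteq> 0}"
  using eventually_compose_filterlim[OF eventually_support_superset assms]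
  by (auto simp: eventually_sequentially)

section \<open>Rates of convergence\<close>

text \<open>
  The three-point inequality telescopes over the second half of the first \<open>n\<close> steps.
  Its left-hand sides decrease, which bounds the last one by the average, and the right-hand side
  is the squared distance at the middle step, which vanishes in the limit: this turns the usual
  bound \<open>O(1/n)\<close> into \<open>o(1/n)\<close>.
\<close>

lemma objective_rate:
  assumes lim: "w \<longlonglongrightarrow> u"
  shows "(\<lambda>k. f (w k) - f u) \<in> o(\<lambda>k. 1 / real k)"
proof -
  have acc: "accumulation_point w u"
    unfolding accumulation_point_def using lim strict_mono_id by (metis comp_id)
  obtain K where K: "\<And>k. k \<ge> K \<Longrightarrow> {i. u $ i \<noteq> 0} \<subseteq> {i. w k $ i \<noteq> 0}"
    using eventually_iterates_support_superset[OF lim] by blast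
  define a where "a k = f (w k) - f u" for k
  define D where "D k = (dist (w k) u)\<^sup>2" for k
  have telescope: "real (n - m) * a n \<le> D m / (2 * lam)" if "K \<le> m" "1 \<le> m" "m \<le> n" for m n
  proof -
    have "real (n - m) * a n = (\<Sum>i\<in>{m..<n}. a n)"
      by simp
    also have "\<dots> \<le> (\<Sum>i\<in>{m..<n}. a (Suc i))"
      using that decseqD[OF objective_decreasing, of _ "n - 1"] by (intro sum_mono) (auto simp: a_def)
    also have "\<dots> \<le> (\<Sum>i\<in>{m..<n}. (D i - D (Suc i)) / (2 * lam))"
      unfolding a_def D_def using that by (intro sum_mono three_point_inequality K) auto
    also have "\<dots> = (\<Sum>i\<in>{m..<n}. D i - D (Suc i)) / (2 * lam)"
      by (simp add: sum_divide_distrib)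
    also have "\<dots> = (D m - D n) / (2 * lam)"
      using sum_Suc_diff'[OF that(3), of "\<lambda>i. - D i"] by simp
    also have "\<dots> \<le> D m / (2 * lam)"
      using step_size by (intro divide_right_mono) (auto simp: D_def)
    finally show ?thesis .
  qed
  have half: "filterlim (\<lambda>n. n div 2) sequentially (sequentially :: nat filter)"
    unfolding filterlim_at_top eventually_sequentially
    by (metis div_le_mono nonzero_mult_div_cancel_left zero_neq_numeral)
  have "(\<lambda>k. dist (w k) u) \<longlonglongrightarrow> 0"
    using lim by (rule tendsto_dist_iff[THEN iffD1])
  then have "D \<longlonglongrightarrow> 0\<^sup>2"
    unfolding D_def by (rule tendsto_power)
  then have "(\<lambda>n. D (n div 2)) \<longlonglongrightarrow> 0"
    using filterlim_compose[OF _ half, of D "nhds 0"] by simp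
  then have D0: "(\<lambda>n. D (n div 2) / lam) \<longlonglongrightarrow> 0"
    using tendsto_divide_zero by blast
  have "(\<lambda>n. real n * a n) \<longlonglongrightarrow> 0"
  proof (rule tendsto_sandwich[OF _ _ tendsto_const D0])
    have a_nonneg: "0 \<le> a n" if "n \<ge> 1" for n
      using accumulation_value_le[OF acc, of "n - 1"] that by (simp add: a_def)
    show "\<forall>\<^sub>F n in sequentially. 0 \<le> real n * a n"
      using a_nonneg by (intro eventually_sequentiallyI[of 1]) simp
    show "\<forall>\<^sub>F n in sequentially. real n * a n \<le> D (n div 2) / lam"
    proof (rule eventually_sequentiallyI)
      fix n assume n: "2 * K + 2 \<le> n"
      have "real n * a n \<le> (2 * real (n - n div 2)) * a n"
        using n by (intro mult_right_mono a_nonneg) linarith+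
      also have "\<dots> \<le> 2 * (D (n div 2) / (2 * lam))"
        unfolding mult.assoc using n by (intro mult_left_mono telescope) auto
      finally show "real n * a n \<le> D (n div 2) / lam"
        by simp
    qed
  qed
  then have "(\<lambda>n. a n / (1 / real n)) \<longlonglongrightarrow> 0"
    by (simp add: mult.commute)
  then show ?thesis
    unfolding a_def[symmetric]
    by (intro smalloI_tendsto) (auto intro: eventually_sequentiallyI[of 1])
qed

text \<open>
  The inequalities that make the iterates nearest points are closed conditions, since the gradient
  is continuous.
\<close>

lemma limit_is_fixed_point:
  assumes lim: "w \<longlonglongrightarrow> u"
  shows "u \<in> T_PG f s lam u"
proof -
  obtain K where K: "\<And>k. k \<ge> K \<Longrightarrow> {i. u $ i \<noteq> 0} \<subseteq> {i. w k $ i \<noteq> 0}"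
    using eventually_iterates_support_superset[OF lim] by blast
  have "u \<in> sparse_set s"
    using sparse_set_line[OF K iterate_sparse, of K 0 1] by simp
  moreover have "dist (gradient_step f lam u) u \<le> dist (gradient_step f lam u) y"
    if "y \<in> sparse_set s" for y
  proof (rule LIMSEQ_le)
    have step: "(\<lambda>k. gradient_step f lam (w k)) \<longlonglongrightarrow> gradient_step f lam u"
      by (rule isCont_tendsto_compose[OF continuous_gradient_step lim])
    show "(\<lambda>k. dist (gradient_step f lam (w k)) (w (Suc k))) \<longlonglongrightarrow> dist (gradient_step f lam u) u"
      by (intro tendsto_dist step LIMSEQ_Suc lim)
    show "(\<lambda>k. dist (gradient_step f lam (w k)) y) \<longlonglongrightarrow> dist (gradient_step f lam u) y"
      by (intro tendsto_dist step tendsto_const)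
    show "\<exists>N. \<forall>k\<ge>N. dist (gradient_step f lam (w k)) (w (Suc k)) \<le> dist (gradient_step f lam (w k)) y"
      using iteration that by (auto simp: T_PG_def proj_set_def)
  qed
  ultimately show ?thesis
    by (simp add: T_PG_def proj_set_def)
qed

text \<open>
  The next iterate and the limit are the projections of \<open>gradient_step f lam (w k)\<close> and of
  \<open>gradient_step f lam u\<close> onto one coordinate subspace, and such projections are nonexpansive.
\<close>

lemma step_distance_le:
  assumes lim: "w \<longlonglongrightarrow> u" and supp: "{i. u $ i \<noteq> 0} \<subseteq> {i. w (Suc k) $ i \<noteq> 0}"
  shows "dist (w (Suc k)) u \<le> dist (gradient_step f lam (w k)) (gradient_step f lam u)"
proof -
  define F where "F = gradient_step f lam"
  define v where "v = w (Suc k) - u"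
  have "(F u - u) \<bullet> v = 0"
  proof (rule proj_set_orthogonal_to_line)
    show "u \<in> proj_set (sparse_set s) (F u)"
      using limit_is_fixed_point[OF lim] by (simp add: T_PG_def F_def)
    show "u + t *\<^sub>R v \<in> sparse_set s" for t
      using sparse_set_line[OF supp iterate_sparse, of t "1 - t"]
      by (simp add: v_def algebra_simps)
  qed
  moreover have "(F (w k) - w (Suc k)) \<bullet> v = 0"
    unfolding F_def v_def by (rule residual_orthogonal[OF supp])
  ultimately have "v \<bullet> v = (F (w k) - F u) \<bullet> v"
    by (simp add: v_def inner_diff_left)
  also have "\<dots> \<le> norm (F (w k) - F u) * norm v"
    by (rule norm_cauchy_schwarz)
  finally have "norm v * norm v \<le> norm (F (w k) - F u) * norm v"
    by (simp add: dot_square_norm power2_eq_square)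
  then have "norm v \<le> norm (F (w k) - F u)"
    by (cases "v = 0") auto
  then show ?thesis
    by (simp add: dist_norm v_def F_def)
qed

lemma common_active_index_set:
  fixes u x :: "real ^ 'n"
  assumes "s \<le> CARD('n)" and supp: "{i. u $ i \<noteq> 0} \<subseteq> {i. x $ i \<noteq> 0}" and x: "x \<in> sparse_set s"
  obtains J where "J \<in> active_index_sets s u" "x \<in> coord_subspace J" "u \<in> coord_subspace J"
proof -
  obtain J where J: "{i. x $ i \<noteq> 0} \<subseteq> J" "card J = s"
    using exists_subset_between[of "{i. x $ i \<noteq> 0}" s UNIV] x assms(1)
    by (auto simp: sparse_set_def l0_norm_def)
  have mem: "x \<in> coord_subspace J" "u \<in> coord_subspace J"
    using J(1) supp by (auto intro!: in_coord_subspace)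
  with J(2) have "J \<in> active_index_sets s u"
    by (simp add: active_index_sets_def index_sets_def)
  with mem show ?thesis
    using that by blast
qed

text \<open>
  Each active index set has its own contraction factor, and the iterates may change index sets for
  ever; finiteness of the index type yields a common factor. Only the previous iterate and the limit
  have to share an index set, since the next projection, whatever its index set, does not increase
  the distance between their gradient steps.
\<close>

lemma eventually_contracting:
  assumes lim: "w \<longlonglongrightarrow> u" and s: "s \<le> CARD('n)"
    and contr: "\<And>J. J \<in> active_index_sets s u \<Longrightarrow> contraction_over (coord_subspace J) (gradient_step f lam)"
  obtains K q where "0 < q" "q < 1" "\<And>k. k \<ge> K \<Longrightarrow> dist (w (Suc k)) u \<le> q * dist (w k) u"
proof -
  obtain K where K: "\<And>k. k \<ge> K \<Longrightarrow> {i. u $ i \<noteq> 0} \<subseteq> {i. w k $ i \<noteq> 0}"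
    using eventually_iterates_support_superset[OF lim] by blast
  obtain \<gamma> where \<gamma>: "\<And>J. J \<in> active_index_sets s u \<Longrightarrow>
      \<gamma> J < 1 \<and> (\<gamma> J)-lipschitz_on (coord_subspace J) (gradient_step f lam)"
    using contr unfolding contraction_over_def by metis
  \<comment> \<open>The value \<open>1/2\<close> keeps the common factor positive, as taking its logarithm requires.\<close>
  define q where "q = Max (insert (1/2) (\<gamma> ` active_index_sets s u))"
  have fin: "finite (insert (1/2) (\<gamma> ` active_index_sets s u))"
    by simp
  have "1/2 \<le> q"
    unfolding q_def by (rule Max_ge[OF fin]) simp
  moreover have "q < 1"
    unfolding q_def using \<gamma> by (subst Max_less_iff[OF fin]) auto
  moreover have "dist (w (Suc k)) u \<le> q * dist (w k) u" if k: "k \<ge> Suc K" for k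
  proof -
    obtain J where J: "J \<in> active_index_sets s u" "w k \<in> coord_subspace J" "u \<in> coord_subspace J"
    proof (rule common_active_index_set[OF s K])
      show "K \<le> k" "w k \<in> sparse_set s"
        using k iterate_sparse[of "k - 1"] by auto
    qed
    have "dist (w (Suc k)) u \<le> dist (gradient_step f lam (w k)) (gradient_step f lam u)"
      using k by (intro step_distance_le[OF lim K]) simp
    also have "\<dots> \<le> \<gamma> J * dist (w k) u"
      using \<gamma>[OF J(1)] J(2,3) lipschitz_onD by blast
    also have "\<dots> \<le> q * dist (w k) u"
      unfolding q_def using J(1) by (intro mult_right_mono Max_ge[OF fin]) auto
    finally show ?thesis .
  qed
  ultimately show ?thesis
    using that[of q "Suc K"] by auto
qed

lemma objective_linear_rate:
  assumes lim: "w \<longlonglongrightarrow> u" and s: "s \<le> CARD('n)"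
    and contr: "\<And>J. J \<in> active_index_sets s u \<Longrightarrow> contraction_over (coord_subspace J) (gradient_step f lam)"
  shows "\<exists>C>0. \<exists>c>0. \<forall>k. f (w k) - f u \<le> C * exp (- c * real k)"
proof -
  obtain K1 q where q: "0 < q" "q < 1"
    and rate: "\<And>k. k \<ge> K1 \<Longrightarrow> dist (w (Suc k)) u \<le> q * dist (w k) u"
    using eventually_contracting[OF lim s contr] by blast
  obtain K2 where K2: "\<And>k. k \<ge> K2 \<Longrightarrow> {i. u $ i \<noteq> 0} \<subseteq> {i. w k $ i \<noteq> 0}"
    using eventually_iterates_support_superset[OF lim] by blast
  define K where "K = max K1 K2"
  have geometric: "dist (w (K + j)) u \<le> q ^ j * dist (w K) u" for j
  proof (induction j)
    case (Suc j)
    have "dist (w (Suc (K + j))) u \<le> q * dist (w (K + j)) u"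
      by (rule rate) (simp add: K_def)
    also have "\<dots> \<le> q * (q ^ j * dist (w K) u)"
      using Suc.IH q by (intro mult_left_mono) auto
    finally show ?case
      by (simp add: mult.assoc)
  qed simp
  define B where "B = (dist (w K) u)\<^sup>2 / (2 * lam)"
  have objective: "f (w (Suc (K + j))) - f u \<le> B * (q\<^sup>2) ^ j" for j
  proof -
    have "f (w (Suc (K + j))) - f u \<le> ((dist (w (K + j)) u)\<^sup>2 - (dist (w (Suc (K + j))) u)\<^sup>2) / (2 * lam)"
      by (intro three_point_inequality K2) (simp add: K_def)
    also have "\<dots> \<le> (q ^ j * dist (w K) u)\<^sup>2 / (2 * lam)"
    proof (intro divide_right_mono)
      have "(dist (w (K + j)) u)\<^sup>2 \<le> (q ^ j * dist (w K) u)\<^sup>2"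
        by (intro power_mono geometric) simp
      then show "(dist (w (K + j)) u)\<^sup>2 - (dist (w (Suc (K + j))) u)\<^sup>2 \<le> (q ^ j * dist (w K) u)\<^sup>2"
        using zero_le_power2[of "dist (w (Suc (K + j))) u"] by linarith
    qed (use step_size in simp)
    also have "\<dots> = B * (q\<^sup>2) ^ j"
      by (simp add: B_def power_mult_distrib power_mult[symmetric] mult.commute)
    finally show ?thesis .
  qed
  define c where "c = - ln (q\<^sup>2)"
  have c: "c > 0"
    using q by (simp add: c_def power_less_one_iff)
  have exp_c: "exp (- c * real n) = (q\<^sup>2) ^ n" for n
    using q by (simp add: c_def exp_of_nat2_mult exp_ln)
  \<comment> \<open>The maximum absorbs the finitely many indices before the geometric decay sets in.\<close>
  define M where "M = Max ((\<lambda>k. \<bar>f (w k) - f u\<bar>) ` {..K})"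
  have M: "\<bar>f (w k) - f u\<bar> \<le> M" if "k \<le> K" for k
    unfolding M_def using that by (intro Max_ge) auto
  have nonneg: "0 \<le> B" "0 \<le> M"
    using step_size M[of K] by (auto simp: B_def)
  \<comment> \<open>Dividing by the power shifts the decay, which starts at index \<open>Suc K\<close>, back to index \<open>0\<close>.\<close>
  define C where "C = (B + M + 1) / (q\<^sup>2) ^ Suc K"
  have "f (w k) - f u \<le> C * exp (- c * real k)" for k
  proof (cases "k \<le> K")
    case True
    have "f (w k) - f u \<le> B + M + 1"
      using M[OF True] nonneg by linarith
    also have "\<dots> = C * (q\<^sup>2) ^ Suc K"
      using q by (simp add: C_def)
    also have "\<dots> \<le> C * (q\<^sup>2) ^ k"
      using True q nonneg
      by (intro mult_left_mono power_decreasing) (auto simp: C_def power_le_one)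
    finally show ?thesis
      by (simp only: exp_c)
  next
    case False
    then obtain j where k: "k = Suc (K + j)"
      by (metis less_iff_Suc_add not_le)
    have "f (w k) - f u \<le> B * (q\<^sup>2) ^ j"
      unfolding k by (rule objective)
    also have "\<dots> \<le> (B + M + 1) * (q\<^sup>2) ^ j"
      using nonneg by (intro mult_right_mono) auto
    also have "\<dots> = C * (q\<^sup>2) ^ k"
      using q by (simp add: C_def k power_add)
    finally show ?thesis
      by (simp only: exp_c)
  qed
  moreover have "C > 0"
    using q nonneg by (auto simp: C_def)
  ultimately show ?thesis
    using c by blast
qed

end

theorem theorem2p2:
  fixes f :: "real ^ 'n \<Rightarrow> real"
    and L lam :: real
    and s :: nat
    and w :: "nat \<Rightarrow> real ^ 'n"
    and wstar :: "real ^ 'n"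
  assumes convex: "convex_on UNIV f"
    and differentiable: "\<forall>x. f differentiable at x"
    and L_pos: "L > 0"
    and Lipschitz: "L-lipschitz_on UNIV (gradient f)"
    and bounded_below: "bdd_below (f ` sparse_set s)"
    and step_size: "0 < lam" "lam < 1 / L"
    and iteration: "\<forall>k. w (Suc k) \<in> T_PG f s lam (w k)"
  shows
    "(w \<longlonglongrightarrow> wstar
        \<longrightarrow> (\<lambda>k. f (w k) - f wstar) \<in> o(\<lambda>k. 1 / real k)) \<and>
     (accumulation_point w wstar \<and> is_singleton (T_PG f s lam wstar)
        \<longrightarrow> w \<longlonglongrightarrow> wstar) \<and>
     (s \<le> CARD('n) \<and> accumulation_point w wstar \<and> is_singleton (T_PG f s lam wstar) \<and>
      (\<forall>J\<in>active_index_sets s wstar. contraction_over (coord_subspace J) (gradient_step f lam))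
        \<longrightarrow> (\<exists>C>0. \<exists>c>0. \<forall>k. f (w k) - f wstar \<le> C * exp (- c * real k)))"
proof -
  interpret sparse_projected_gradient f L lam s w
    using convex differentiable L_pos Lipschitz step_size iteration by unfold_locales auto
  show ?thesis
    using objective_rate accumulation_point_imp_limit objective_linear_rate by blast
qed

end
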